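(* Let $K, N \ge 1$ be integers and let $k \in \{1,\dots,K\}$. For each $n \in \{1,\dots,N\}$ let $\boldsymbol{z}_n = (z_{n,i})_{1\le i\le K}$ belong to the unit simplex of $\mathbb{R}^K$ with all components strictly positive, and let $\boldsymbol{u}_n=(u_{n,j})_{1\le j\le K}$ belong to the unit simplex of $\mathbb{R}^K$. Define $F_k : (0,+\infty)^K \to \mathbb{R}$ by $$F_k(\boldsymbol{\alpha}_k) = \sum_{n=1}^N u_{n,k}\left( \sum_{i=1}^K -(\alpha_{k,i}-1)\ln z_{n,i} + \sum_{i=1}^K \ln\Gamma(\alpha_{k,i}) - \ln\Gamma\Big(\sum_{i=1}^K \alpha_{k,i}\Big)\right),$$ where $\boldsymbol{\alpha}_k = (\alpha_{k,i})_{1\le i\le K}$. Let $\varphi(t) = \ln\Gamma(t+1)$ for $t \in [0,+\infty)$, and define $c$ on $[0,+\infty)$ by $$c(t) = \begin{cases} \varphi''(0) & \text{if } t=0,\\ 2\,\dfrac{\varphi(0)-\varphi(t)+\varphi'(t)\,t}{t^2} & \text{otherwise.}\end{cases}$$ Then, for any $\boldsymbol{\beta}_k = (\beta_{k,i})_{1\le i\le K}\in(0,+\infty)^K$, the function $q(\,\cdot\,;\boldsymbol{\beta}_k)$ defined for every $\boldsymbol{\alpha}_k\in(0,+\infty)^K$ by $$\begin{aligned} q(\boldsymbol{\alpha}_k;\boldsymbol{\beta}_k) = \sum_{n=1}^N u_{n,k}\Bigg[ &\sum_{i=1}^K\Big( -(\alpha_{k,i}-1)\ln z_{n,i} - \ln\alpha_{k,i}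 + \varphi(\beta_{k,i}) + \varphi'(\beta_{k,i})(\alpha_{k,i}-\beta_{k,i}) + \frac{c(\beta_{k,i})}{2}(\alpha_{k,i}-\beta_{k,i})^2\Big)\\ & - \ln\Gamma\Big(\sum_{i=1}^K\beta_{k,i}\Big) - \Big(\sum_{i=1}^K(\alpha_{k,i}-\beta_{k,i})\Big)(\ln\Gamma)'\Big(\sum_{i=1}^K\beta_{k,i}\Big)\Bigg]\end{aligned}$$ is a tangent majorant of $F_k$ at $\boldsymbol{\beta}_k$, i.e. $F_k(\boldsymbol{\alpha}_k)\le q(\boldsymbol{\alpha}_k;\boldsymbol{\beta}_k)$ for every $\boldsymbol{\alpha}_k\in(0,+\infty)^K$ and $F_k(\boldsymbol{\beta}_k) = q(\boldsymbol{\beta}_k;\boldsymbol{\beta}_k)$.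
   Context: $\Gamma$ is the Gamma function and $(\ln\Gamma)'$ is the derivative of $\ln\Gamma$ (the digamma function). The unit simplex of $\mathbb{R}^K$ is $\Delta_K=\{\boldsymbol{p}\in[0,+\infty)^K : \sum_{k=1}^K p_k = 1\}$. *)

theory Defs
  imports "HOL-Analysis.Analysis"
begin

definition unit_simplex :: "(real ^ 'K) set" where
  "unit_simplex = {p. (\<forall>i. 0 \<le> p $ i) \<and> (\<Sum>i\<in>UNIV. p $ i) = 1}"

definition pos_orthant :: "(real ^ 'K) set" where
  "pos_orthant = {a. \<forall>i. 0 < a $ i}"

definition tangent_majorant_on ::
    "'a set \<Rightarrow> ('a \<Rightarrow> real) \<Rightarrow> ('a \<Rightarrow> real) \<Rightarrow> 'a \<Rightarrow> bool" where
  "tangent_majorant_on D f g y \<longleftrightarrow> (\<forall>x\<in>D. f x \<le> g x) \<and> f y = g y"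

text \<open>The library function \<open>ln_Gamma\<close> agrees with \<open>ln (Gamma x)\<close> for every real
  \<open>x > 0\<close>; only such arguments matter below.\<close>

definition F ::
    "nat \<Rightarrow> (nat \<Rightarrow> real ^ 'K) \<Rightarrow> (nat \<Rightarrow> real ^ 'K) \<Rightarrow> 'K \<Rightarrow> real ^ 'K \<Rightarrow> real" where
  "F N u z k \<alpha> =
     (\<Sum>n=1..N. u n $ k *
        ((\<Sum>i\<in>UNIV. - (\<alpha> $ i - 1) * ln (z n $ i))
         + (\<Sum>i\<in>UNIV. ln_Gamma (\<alpha> $ i))
         - ln_Gamma (\<Sum>i\<in>UNIV. \<alpha> $ i)))"

text \<open>The functions \<open>phi\<close> and \<open>c\<close> are meant on \<open>{0..}\<close>. The formula for \<open>phi\<close> is smooth on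
  \<open>{-1<..}\<close>, so its two-sided derivatives at \<open>0\<close> coincide with the one-sided ones.\<close>

definition phi :: "real \<Rightarrow> real" where
  "phi t = ln_Gamma (t + 1)"

definition c :: "real \<Rightarrow> real" where
  "c t = (if t = 0 then deriv (deriv phi) 0
          else 2 * ((phi 0 - phi t + deriv phi t * t) / t\<^sup>2))"

definition q ::
    "nat \<Rightarrow> (nat \<Rightarrow> real ^ 'K) \<Rightarrow> (nat \<Rightarrow> real ^ 'K) \<Rightarrow> 'K \<Rightarrow> real ^ 'K \<Rightarrow> real ^ 'K \<Rightarrow> real" where
  "q N u z k \<alpha> \<beta> =
     (\<Sum>n=1..N. u n $ k *
        ((\<Sum>i\<in>UNIV. - (\<alpha> $ i - 1) * ln (z n $ i) - ln (\<alpha> $ i)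
            + phi (\<beta> $ i) + deriv phi (\<beta> $ i) * (\<alpha> $ i - \<beta> $ i)
            + c (\<beta> $ i) / 2 * (\<alpha> $ i - \<beta> $ i)\<^sup>2)
         - ln_Gamma (\<Sum>i\<in>UNIV. \<beta> $ i)
         - (\<Sum>i\<in>UNIV. \<alpha> $ i - \<beta> $ i) * deriv ln_Gamma (\<Sum>i\<in>UNIV. \<beta> $ i)))"

end

theory Submission
  imports Defs
begin

text \<open>
  The function \<open>F\<close> splits into a concave part, \<open>- ln_Gamma\<close> of the sum of the coordinates, which
  lies below its tangent, and a separable part. There
  \<open>ln_Gamma t = phi t - ln t\<close>, where \<open>phi\<close> is majorised by a parabola. The constant \<open>c \<beta>\<close> is
  chosen so that the gap \<open>g\<close> between the tangent parabola at \<open>\<beta>\<close> and \<open>phi\<close> vanishes at \<open>0\<close> as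
  well as at \<open>\<beta>\<close>. By Rolle, \<open>g'\<close> then vanishes at some point \<open>d\<close> strictly between \<open>0\<close> and \<open>\<beta>\<close>, in
  addition to \<open>\<beta>\<close>. Since \<open>phi'\<close> is concave, \<open>g'\<close> is convex, so it is nonpositive on \<open>{d..\<beta>}\<close> and
  nonnegative elsewhere; hence \<open>g \<ge> 0\<close>.
\<close>

text \<open>The zero at \<open>d\<close> lies below the chord from \<open>y\<close> to
  \<open>b\<close>, whose height there is \<open>h y\<close> times a positive factor.\<close>

lemma convex_on_nonneg_left_of_zeros:
  fixes h :: "real \<Rightarrow> real"
  assumes "convex_on {y..b} h" "h d = 0" "h b = 0" "y \<le> d" "d < b"
  shows "0 \<le> h y"
proof -
  have "h d \<le> (h b - h y) / (b - y) * (d - y) + h y"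
    by (rule convex_onD_Icc') (use assms in auto)
  also have "\<dots> = h y * ((b - d) / (b - y))"
    using assms by (simp add: field_simps)
  finally show ?thesis
    using assms by (auto simp: zero_le_mult_iff zero_le_divide_iff)
qed

text \<open>Mirror argument: the chord runs from \<open>d\<close> to \<open>y\<close> and is
  evaluated at \<open>b\<close>.\<close>

lemma convex_on_nonneg_right_of_zeros:
  fixes h :: "real \<Rightarrow> real"
  assumes "convex_on {d..y} h" "h d = 0" "h b = 0" "d < b" "b \<le> y"
  shows "0 \<le> h y"
proof -
  have "h b \<le> (h y - h d) / (y - d) * (b - d) + h d"
    by (rule convex_onD_Icc') (use assms in auto)
  also have "\<dots> = h y * ((b - d) / (y - d))"
    using assms by (simp add: field_simps)
  finally show ?thesis
    using assms by (auto simp: zero_le_mult_iff zero_le_divide_iff)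
qed

lemma convex_on_nonpos_between_zeros:
  fixes h :: "real \<Rightarrow> real"
  assumes "convex_on {d..b} h" "h d = 0" "h b = 0" "d \<le> y" "y \<le> b"
  shows "h y \<le> 0"
  using convex_onD_Icc'[OF assms(1), of y] assms by simp

lemma nonneg_if_convex_deriv:
  fixes g g' :: "real \<Rightarrow> real"
  assumes deriv: "\<And>x. 0 \<le> x \<Longrightarrow> (g has_real_derivative g' x) (at x)"
    and conv: "convex_on {0..} g'"
    and zeros: "g 0 = 0" "g b = 0" "g' b = 0"
    and "0 < b" "0 \<le> x"
  shows "0 \<le> g x"
proof -
  have "\<exists>d. 0 < d \<and> d < b \<and> g' d = 0"
  proof -
    have "continuous_on {0..b} g"
      by (rule DERIV_continuous_on[where D = g'])
        (auto intro: deriv has_field_derivative_at_within)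
    then obtain d where d: "0 < d" "d < b" "(*) (g' d) = (\<lambda>v. 0)"
      using Rolle_deriv[of 0 b g "\<lambda>x. (*) (g' x)"] zeros \<open>0 < b\<close> deriv
      by (auto simp: has_field_derivative_def)
    \<comment> \<open>Rolle yields the derivative as the zero linear map; its value at 1 is the
      number \<open>g' d\<close>.\<close>
    have "g' d = 0"
      using fun_cong[OF d(3), of 1] by simp
    with d show ?thesis by blast
  qed
  then obtain d where d: "0 < d" "d < b" "g' d = 0" by blast
  have sub: "convex_on {s..t} g'" if "0 \<le> s" for s t
    using conv by (rule convex_on_subset) (use that in auto)
  \<comment> \<open>\<open>g\<close> rises from its zero at \<open>0\<close> up to \<open>d\<close>,
    falls to its zero at \<open>b\<close>, then rises again, so each case compares
    \<open>g x\<close> with a zero of \<open>g\<close>.\<close>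
  consider "x \<le> d" | "d \<le> x" "x \<le> b" | "b \<le> x" by linarith
  then show ?thesis
  proof cases
    case 1
    have "g 0 \<le> g x"
    proof (rule DERIV_nonneg_imp_nondecreasing[where f = g])
      fix y assume "0 \<le> y" "y \<le> x"
      then show "\<exists>D. DERIV g y :> D \<and> 0 \<le> D"
        using deriv convex_on_nonneg_left_of_zeros[OF sub, of y d b] zeros d 1 by force
    qed (use \<open>0 \<le> x\<close> in simp)
    then show ?thesis using zeros by simp
  next
    case 2
    have "g b \<le> g x"
    proof (rule DERIV_nonpos_imp_nonincreasing[where f = g])
      fix y assume "x \<le> y" "y \<le> b"
      then show "\<exists>D. DERIV g y :> D \<and> D \<le> 0"
        using deriv[of y] convex_on_nonpos_between_zeros[OF sub, of d b y] zeros d 2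
        by (intro exI[of _ "g' y"]) simp
    qed (use 2 in simp)
    then show ?thesis using zeros by simp
  next
    case 3
    have "g b \<le> g x"
    proof (rule DERIV_nonneg_imp_nondecreasing[where f = g])
      fix y assume "b \<le> y" "y \<le> x"
      then show "\<exists>D. DERIV g y :> D \<and> 0 \<le> D"
        using deriv[of y] convex_on_nonneg_right_of_zeros[OF sub, of d b y] zeros d
        by (intro exI[of _ "g' y"]) simp
    qed (use 3 in simp)
    then show ?thesis using zeros by simp
  qed
qed

lemma parabola_majorant:
  fixes f f' :: "real \<Rightarrow> real"
  assumes deriv: "\<And>x. 0 \<le> x \<Longrightarrow> (f has_real_derivative f' x) (at x)"
    and conv: "convex_on {0..} (\<lambda>x. - f' x)"
    and "0 < b" "0 \<le> x"
  shows "f x \<le> f b + f' b * (x - b) + (f 0 - f b + f' b * b) / b\<^sup>2 * (x - b)\<^sup>2"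
proof -
  define C where "C = (f 0 - f b + f' b * b) / b\<^sup>2"
  define g where "g y = f b + f' b * (y - b) + C * (y - b)\<^sup>2 - f y" for y
  define g' where "g' y = - f' y + (f' b + 2 * C * (y - b))" for y
  have "0 \<le> g x"
  proof (rule nonneg_if_convex_deriv[where b = b and g = g and g' = g'])
    show "(g has_real_derivative g' y) (at y)" if "0 \<le> y" for y
      unfolding g_def g'_def
      by (auto intro!: derivative_eq_intros deriv that)
    have "convex_on {0..} (\<lambda>y. f' b + 2 * C * (y - b))"
      by (rule convex_on_realI[where f' = "\<lambda>_. 2 * C"])
        (auto intro!: derivative_eq_intros)
    then show "convex_on {0..} g'"
      unfolding g'_def by (rule convex_on_add[OF conv])
    \<comment> \<open>The value of \<open>C\<close> enters here: it makes the parabola meet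
      \<open>f\<close> at \<open>0\<close>. Contact at \<open>b\<close> holds for any quadratic
      coefficient.\<close>
    have "C * b\<^sup>2 = f 0 - f b + f' b * b"
      using \<open>0 < b\<close> by (simp add: C_def)
    then show "g 0 = 0" by (simp add: g_def)
  qed (use assms in \<open>auto simp: g_def g'_def\<close>)
  then show ?thesis by (simp add: g_def C_def)
qed

lemma phi_has_derivative:
  assumes "0 \<le> x"
  shows "(phi has_real_derivative Digamma (x + 1)) (at x)"
  unfolding phi_def[abs_def] using assms by (auto intro!: derivative_eq_intros)

text \<open>The trigamma function \<open>Polygamma 1\<close> decreases on the positive reals, so
  \<open>Digamma\<close> is concave there.\<close>

lemma convex_on_minus_Digamma: "convex_on {0..} (\<lambda>x::real. - Digamma (x + 1))"
proof (rule convex_on_realI[where f' = "\<lambda>x. - Polygamma 1 (x + 1)"])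
  show "((\<lambda>x. - Digamma (x + 1)) has_real_derivative - Polygamma 1 (x + 1)) (at x)"
    if "x \<in> {0..}" for x :: real
    using that by (auto intro!: derivative_eq_intros elim!: nonpos_Ints_cases')
  show "- Polygamma 1 (x + 1) \<le> - Polygamma 1 (y + 1)"
    if "x \<in> {0..}" "y \<in> {0..}" "x \<le> y" for x y :: real
    using that Polygamma_real_strict_antimono[of "x + 1" "y + 1" 1] by (cases "x = y") auto
qed simp

lemma phi_le_parabola:
  assumes "0 < b" "0 \<le> x"
  shows "phi x \<le> phi b + deriv phi b * (x - b) + c b / 2 * (x - b)\<^sup>2"
proof -
  have "deriv phi b = Digamma (b + 1)"
    using assms by (intro DERIV_imp_deriv phi_has_derivative) auto
  moreover have "c b / 2 = (phi 0 - phi b + deriv phi b * b) / b\<^sup>2"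
    using assms by (simp add: c_def field_simps)
  ultimately show ?thesis
    using parabola_majorant[OF phi_has_derivative convex_on_minus_Digamma assms] by (simp only:)
qed

text \<open>The functional equation of \<open>Gamma\<close> in logarithmic form. It isolates the
  singularity at \<open>0\<close> in \<open>- ln x\<close>, which \<open>q\<close> keeps
  exactly.\<close>

lemma ln_Gamma_eq_phi:
  assumes "0 < x"
  shows "ln_Gamma x = phi x - ln x"
proof -
  have "Gamma (x + 1) = x * Gamma x"
    using assms by (intro Gamma_plus1) (auto elim!: nonpos_Ints_cases')
  then show ?thesis
    using assms by (simp add: phi_def ln_Gamma_real_pos ln_mult_pos Gamma_real_pos)
qed

text \<open>\<open>ln_Gamma\<close> is convex because its derivative \<open>Digamma\<close>
  increases on the positive reals.\<close>

lemma ln_Gamma_above_tangent: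
  fixes x y :: real
  assumes "0 < x" "0 < y"
  shows "ln_Gamma y + (x - y) * deriv ln_Gamma y \<le> ln_Gamma x"
proof -
  have "convex_on {0<..} (ln_Gamma :: real \<Rightarrow> real)"
    by (rule convex_on_realI[where f' = Digamma])
      (auto intro!: derivative_eq_intros Polygamma_real_mono)
  then have "Digamma y * (x - y) \<le> ln_Gamma x - ln_Gamma y"
    by (rule convex_on_imp_above_tangent)
      (use assms in \<open>auto simp: interior_open intro!: has_field_derivative_at_within derivative_intros\<close>)
  then show ?thesis
    using assms by (simp add: deriv_ln_Gamma_real algebra_simps)
qed

theorem lemma1:
  fixes N :: nat
    and z u :: "nat \<Rightarrow> real ^ 'K"
    and k :: 'K
    and \<beta> :: "real ^ 'K"
  assumes "1 \<le> N"
    and "\<And>n. n \<in> {1..N} \<Longrightarrow> z n \<in> unit_simplex"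
    and "\<And>n i. n \<in> {1..N} \<Longrightarrow> 0 < z n $ i"
    and "\<And>n. n \<in> {1..N} \<Longrightarrow> u n \<in> unit_simplex"
    and "\<beta> \<in> pos_orthant"
  shows "tangent_majorant_on pos_orthant (F N u z k) (\<lambda>\<alpha>. q N u z k \<alpha> \<beta>) \<beta>"
  unfolding tangent_majorant_on_def
proof (intro conjI ballI)
  have \<beta>: "0 < \<beta> $ i" for i
    using assms(5) by (simp add: pos_orthant_def)
  \<comment> \<open>At \<alpha> = \<beta> all linear and quadratic terms vanish, leaving
    \<open>phi - ln\<close> in each coordinate.\<close>
  show "F N u z k \<beta> = q N u z k \<beta> \<beta>"
    unfolding F_def q_def
    by (simp add: ln_Gamma_eq_phi[OF \<beta>] sum.distrib[symmetric] diff_add_eq add_diff_eq)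
  fix \<alpha> :: "real ^ 'K"
  assume "\<alpha> \<in> pos_orthant"
  then have \<alpha>: "0 < \<alpha> $ i" for i
    by (simp add: pos_orthant_def)
  have tangent: "ln_Gamma (\<Sum>i\<in>UNIV. \<beta> $ i) +
      (\<Sum>i\<in>UNIV. \<alpha> $ i - \<beta> $ i) * deriv ln_Gamma (\<Sum>i\<in>UNIV. \<beta> $ i)
      \<le> ln_Gamma (\<Sum>i\<in>UNIV. \<alpha> $ i)"
    unfolding sum_subtractf
    by (intro ln_Gamma_above_tangent sum_pos) (auto simp: \<alpha> \<beta>)
  \<comment> \<open>The terms in \<open>ln (z n $ i)\<close> agree on both sides, so the parabola
    bound for \<open>phi\<close> suffices coordinatewise.\<close>
  have separable: "(\<Sum>i\<in>UNIV. - (\<alpha> $ i - 1) * ln (z n $ i)) + (\<Sum>i\<in>UNIV. ln_Gamma (\<alpha> $ i))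
      \<le> (\<Sum>i\<in>UNIV. - (\<alpha> $ i - 1) * ln (z n $ i) - ln (\<alpha> $ i)
            + phi (\<beta> $ i) + deriv phi (\<beta> $ i) * (\<alpha> $ i - \<beta> $ i)
            + c (\<beta> $ i) / 2 * (\<alpha> $ i - \<beta> $ i)\<^sup>2)" for n
    unfolding sum.distrib[symmetric]
  proof (rule sum_mono)
    fix i
    show "- (\<alpha> $ i - 1) * ln (z n $ i) + ln_Gamma (\<alpha> $ i)
      \<le> - (\<alpha> $ i - 1) * ln (z n $ i) - ln (\<alpha> $ i)
            + phi (\<beta> $ i) + deriv phi (\<beta> $ i) * (\<alpha> $ i - \<beta> $ i)
            + c (\<beta> $ i) / 2 * (\<alpha> $ i - \<beta> $ i)\<^sup>2"
      using phi_le_parabola[OF \<beta> less_imp_le[OF \<alpha>], of i i] ln_Gamma_eq_phi[OF \<alpha>, of i]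
      by linarith
  qed
  show "F N u z k \<alpha> \<le> q N u z k \<alpha> \<beta>"
    unfolding F_def q_def
  \<comment> \<open>The weights \<open>u n $ k\<close> are nonnegative, so it suffices to compare
    the brackets for each \<open>n\<close>.\<close>
  proof (intro sum_mono mult_left_mono)
    fix n assume "n \<in> {1..N}"
    then show "0 \<le> u n $ k"
      using assms(4) by (simp add: unit_simplex_def)
  qed (use tangent separable in \<open>smt (verit)\<close>)
qed

end
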